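(* Let $d,\alpha,\delta,\varepsilon>0$ with $\alpha,\delta<1$. Then there is a constant $C_0$ such that for all $C\ge C_0$ and $n\in\mathbb{N}$ the following holds. If $F$ is a subgraph of $K_n$ with $\Delta(F)\le d$ and $k_0:=|E(F)|=\omega(1)$, and the hypergraph $\mathcal{F}$ of all copies of $F$ in $K_n$ is $(q,\alpha,\delta)$-superspread with $q\ge 4k_0/(Cn^2)$, then for every $p\ge Cq$, \[\mathbb{P}[F\subseteq G(n,p)]\ge 1-\varepsilon,\] where $F\subseteq G(n,p)$ means that $G(n,p)$ contains a copy of $F$.
   Context: Copies of $F$ in $K_n$ are identified with their edge sets, so $\mathcal{F}$ is a $k_0$-uniform hypergraph on vertex set $M=\binom{[n]}{2}$. For $I\subseteq M$, $\mathcal{F}\cap\langle I\rangle$ denotes the set of members of $\mathcal{F}$ containing $I$. $\mathcal{F}$ is $q$-spread if $|\mathcal{F}\cap\langle I\rangle|\le q^{|I|}|\mathcal{F}|$ for all $I\subseteq M$. For $q,\alpha,\delta\in(0,1)$, $\mathcal{F}$ (with $k=k_0$) is $(q,\alpha,\delta)$-superspread if it is $q$-spread and for every $I\subseteq M$ with $|I|\le\delta k$ we have $|\mathcal{F}\cap\langle I\rangle|\le q^{|I|}k^{-\alpha c_I}|\mathcal{F}|$, where $c_I$ is the number of connected components of the graph formed by the edge set $I$. The hypothesis $\omega(1)$ refers to $n\to\infty$. *)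

theory Defs
  imports "HOL-Probability.Probability" "HOL-Library.Landau_Symbols"
begin

text \<open>
  A finite simple graph without isolated vertices is represented by its edge set, edges being
  two-element vertex sets. Isolated vertices of a subgraph of \<open>K\<^sub>n\<close> affect neither its maximum
  degree nor (copies being identified with their edge sets) its set of copies in \<open>K\<^sub>n\<close>.
\<close>

definition complete_edges :: "nat \<Rightarrow> nat set set" where
  "complete_edges n = {e. e \<subseteq> {1..n} \<and> card e = 2}"

definition vertex_degree :: "'v set set \<Rightarrow> 'v \<Rightarrow> nat" where
  "vertex_degree E v = card {e \<in> E. v \<in> e}"

text \<open>The inserted 0 only matters for the graph with no edges.\<close>

definition max_degree :: "'v set set \<Rightarrow> nat" where
  "max_degree E = Max (insert 0 (vertex_degree E ` \<Union>E))"

definition connected_rel :: "'v set set \<Rightarrow> 'v rel" where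
  "connected_rel E = {(u, v). u \<in> \<Union>E \<and> v \<in> \<Union>E \<and> (u, v) \<in> {(x, y). {x, y} \<in> E}\<^sup>*}"

definition num_components :: "'v set set \<Rightarrow> nat" where
  "num_components E = card (\<Union>E // connected_rel E)"

definition copies :: "nat \<Rightarrow> nat set set \<Rightarrow> nat set set set" where
  "copies n F = {(\<lambda>e. f ` e) ` F | f. inj_on f (\<Union>F) \<and> f ` \<Union>F \<subseteq> {1..n}}"

definition members_containing :: "'a set set \<Rightarrow> 'a set \<Rightarrow> 'a set set" where
  "members_containing H I = {A \<in> H. I \<subseteq> A}"

definition spread :: "'a set \<Rightarrow> real \<Rightarrow> 'a set set \<Rightarrow> bool" where
  "spread M q H \<longleftrightarrow>
     (\<forall>I\<subseteq>M. real (card (members_containing H I)) \<le> q ^ card I * real (card H))"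

text \<open>
  Here \<open>H\<close> is a \<open>k\<close>-uniform hypergraph whose vertex set \<open>M\<close> consists of graph edges.
  The factor \<open>k\<^bsup>-\<alpha>c\<^esup>\<close> is written \<open>(k\<^bsup>-\<alpha>\<^esup>)\<^bsup>c\<^esup>\<close> with a natural exponent \<open>c\<close>, so that it is 1
  for \<open>c = 0\<close> also when \<open>k = 0\<close> (whereas \<open>0 powr 0 = 0\<close>).
\<close>

definition superspread ::
    "'v set set \<Rightarrow> nat \<Rightarrow> real \<Rightarrow> real \<Rightarrow> real \<Rightarrow> 'v set set set \<Rightarrow> bool" where
  "superspread M k q \<alpha> \<delta> H \<longleftrightarrow>
     q \<in> {0<..<1} \<and> \<alpha> \<in> {0<..<1} \<and> \<delta> \<in> {0<..<1} \<and>
     spread M q H \<and>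
     (\<forall>I\<subseteq>M. real (card I) \<le> \<delta> * real k \<longrightarrow>
        real (card (members_containing H I))
          \<le> q ^ card I * (real k powr (-\<alpha>)) ^ num_components I * real (card H))"

definition gnp :: "nat \<Rightarrow> real \<Rightarrow> nat set set pmf" where
  "gnp n p = map_pmf (\<lambda>x. {e \<in> complete_edges n. x e})
     (Pi_pmf (complete_edges n) False (\<lambda>_. bernoulli_pmf p))"

end

theory Submission imports Defs begin

text \<open>
  Expose the random graph in a bounded number of independent rounds. In each round with random
  set \<open>W\<close>, replace every surviving piece \<open>\<phi> S\<close> of a copy \<open>S\<close> by its minimum fragment \<open>\<phi> S' - W\<close>, where
  \<open>\<phi> S' \<subseteq> W \<union> \<phi> S\<close>. A fragment \<open>T\<close> lies inside every piece contained in \<open>Z = W \<union> T\<close>, so \<open>(W, T)\<close> can be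
  recovered from \<open>Z\<close> and a subset \<open>T\<close> of one fixed piece inside \<open>Z\<close>; this bounds the
  expected number of copies with large fragments by a sum over the subsets \<open>T\<close> of a single piece.
  Superspreadness gives \<open>T\<close> the weight \<open>C\<^bsup>-|T|\<^esup> x\<^bsup>c(T)\<^esup>\<close> with \<open>x = k\<^bsup>-\<alpha>\<^esup>\<close>, and in a graph of bounded
  degree with \<open>m\<close> edges the total of \<open>y\<^bsup>|T|\<^esup> x\<^bsup>c(T)\<^esup>\<close> is at most \<open>(1 + x)\<^bsup>m\<^esup> \<le> e\<^bsup>xm\<^esup>\<close> for small \<open>y\<close>. Hence a round
  shrinks the pieces of most copies by the factor \<open>x\<close>, and after about \<open>1/\<alpha>\<close> rounds some piece is empty.
\<close>

section \<open>Random subsets\<close>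

text \<open>The mass at \<open>W\<close> of the random subset of \<open>M\<close> that keeps each
  element independently with probability \<open>p\<close>. Finite sums over these masses replace the
  measure, so that induction on \<open>M\<close> applies.\<close>

definition subset_weight :: "'a set \<Rightarrow> real \<Rightarrow> 'a set \<Rightarrow> real" where
  "subset_weight M p W = p ^ card W * (1 - p) ^ card (M - W)"

definition subset_expectation :: "'a set \<Rightarrow> real \<Rightarrow> ('a set \<Rightarrow> real) \<Rightarrow> real" where
  "subset_expectation M p f = (\<Sum>W\<in>Pow M. subset_weight M p W * f W)"

lemma subset_weight_nonneg: "0 \<le> p \<Longrightarrow> p \<le> 1 \<Longrightarrow> 0 \<le> subset_weight M p W"
  by (simp add: subset_weight_def)

lemma sum_Pow_insert:
  fixes f :: "'a set \<Rightarrow> real"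
  assumes "finite A" "a \<notin> A"
  shows "(\<Sum>B\<in>Pow (insert a A). f B) = (\<Sum>B\<in>Pow A. f B) + (\<Sum>B\<in>Pow A. f (insert a B))"
proof -
  have "inj_on (insert a) (Pow A)"
    using assms(2) by (auto simp: inj_on_def)
  moreover have "Pow A \<inter> insert a ` Pow A = {}"
    using assms(2) by auto
  ultimately show ?thesis
    using assms(1) by (simp add: Pow_insert sum.union_disjoint sum.reindex)
qed

text \<open>Condition on whether \<open>a\<close> is selected.\<close>

lemma subset_expectation_insert:
  assumes "finite A" "a \<notin> A"
  shows "subset_expectation (insert a A) p f =
    (1 - p) * subset_expectation A p f + p * subset_expectation A p (\<lambda>W. f (insert a W))"
proof -
  have "subset_weight (insert a A) p W = (1 - p) * subset_weight A p W" if "W \<subseteq> A" for W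
  proof -
    have "insert a A - W = insert a (A - W)" using that assms(2) by auto
    then show ?thesis using assms by (simp add: subset_weight_def)
  qed
  moreover have "subset_weight (insert a A) p (insert a W) = p * subset_weight A p W"
    if "W \<subseteq> A" for W
  proof -
    have "insert a A - insert a W = A - W" using that assms(2) by auto
    moreover have "card (insert a W) = Suc (card W)"
      using that assms finite_subset by (intro card_insert_disjoint) auto
    ultimately show ?thesis by (simp add: subset_weight_def)
  qed
  ultimately show ?thesis
    using assms
    by (auto simp: subset_expectation_def sum_Pow_insert sum_distrib_left mult.assoc
        intro!: arg_cong2[where f = "(+)"] sum.cong)
qed

lemma subset_expectation_linear:
  "subset_expectation M p (\<lambda>W. a * f W + b * g W) =
    a * subset_expectation M p f + b * subset_expectation M p g"
  by (simp add: subset_expectation_def sum_distrib_left sum.distrib algebra_simps)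

lemma subset_expectation_mono:
  assumes "0 \<le> p" "p \<le> 1" "\<And>W. W \<subseteq> M \<Longrightarrow> f W \<le> g W"
  shows "subset_expectation M p f \<le> subset_expectation M p g"
  unfolding subset_expectation_def
  by (intro sum_mono mult_left_mono) (use assms in \<open>auto simp: subset_weight_nonneg\<close>)

lemma subset_expectation_const:
  assumes "finite M"
  shows "subset_expectation M p (\<lambda>_. c) = c"
  using assms
proof (induction M)
  case empty
  then show ?case by (simp add: subset_expectation_def subset_weight_def)
next
  case (insert a M)
  then show ?case by (simp add: subset_expectation_insert algebra_simps)
qed

text \<open>Two independent rounds with rates \<open>r\<close> and \<open>t\<close> both miss an
  element with probability \<open>(1 - r) * (1 - t)\<close>. This splits one exposure into
  successive rounds.\<close>

lemma subset_expectation_union: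
  assumes "finite M"
  shows "subset_expectation M (1 - (1 - r) * (1 - t)) f =
    subset_expectation M r (\<lambda>V. subset_expectation M t (\<lambda>W. f (V \<union> W)))"
  using assms
proof (induction M arbitrary: f)
  case empty
  then show ?case by (simp add: subset_expectation_def subset_weight_def)
next
  case (insert a M)
  have eq1: "subset_expectation M r (\<lambda>V. subset_expectation (insert a M) t (\<lambda>W. f (V \<union> W))) =
      (1 - t) * subset_expectation M r (\<lambda>V. subset_expectation M t (\<lambda>W. f (V \<union> W))) +
      t * subset_expectation M r (\<lambda>V. subset_expectation M t (\<lambda>W. f (insert a (V \<union> W))))"
    using insert.hyps by (simp add: subset_expectation_insert subset_expectation_linear)
  have eq2: "subset_expectation M r
        (\<lambda>V. subset_expectation (insert a M) t (\<lambda>W. f (insert a V \<union> W))) =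
      subset_expectation M r (\<lambda>V. subset_expectation M t (\<lambda>W. f (insert a (V \<union> W))))"
    using insert.hyps by (simp add: subset_expectation_insert algebra_simps)
  have eq3: "subset_expectation (insert a M) (1 - (1 - r) * (1 - t)) f =
      (1 - r) * (1 - t) * subset_expectation M r (\<lambda>V. subset_expectation M t (\<lambda>W. f (V \<union> W))) +
      (1 - (1 - r) * (1 - t)) *
        subset_expectation M r (\<lambda>V. subset_expectation M t (\<lambda>W. f (insert a (V \<union> W))))"
    unfolding subset_expectation_insert[OF insert.hyps] insert.IH by simp
  show ?case
    unfolding eq3 subset_expectation_insert[OF insert.hyps, of r] eq1 eq2 by algebra
qed

section \<open>Minimum fragments\<close>

text \<open>The indices in \<open>G\<close> are copies and \<open>\<phi> S\<close> is what is left
  of \<open>S\<close>; copies with equal pieces are counted separately. A pair \<open>(W, S)\<close>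
  with a fragment \<open>T\<close> larger than \<open>s\<close> is charged to
  \<open>(W \<union> T, T, S)\<close>. Passing from \<open>W\<close> to \<open>W \<union> T\<close>
  costs at most a factor \<open>1 / p ^ card T\<close>, and for each union the hypothesis bounds the
  total of these costs by \<open>D\<close>.\<close>

lemma minimum_fragment:
  fixes \<phi> :: "'b \<Rightarrow> 'a set"
  assumes M: "finite M" and G: "finite G" and p: "0 < p" "p \<le> 1" and D: "0 \<le> D"
    and sub: "\<And>S. S \<in> G \<Longrightarrow> \<phi> S \<subseteq> M"
    and bound: "\<And>S. S \<in> G \<Longrightarrow>
      (\<Sum>T | T \<subseteq> \<phi> S \<and> s < card T. real (card {S'\<in>G. T \<subseteq> \<phi> S'}) / p ^ card T) \<le> D"
  obtains \<tau> where
    "\<And>W S. W \<subseteq> M \<Longrightarrow> S \<in> G \<Longrightarrow> \<tau> W S \<subseteq> \<phi> S"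
    "\<And>W S. W \<subseteq> M \<Longrightarrow> S \<in> G \<Longrightarrow> \<exists>S'\<in>G. \<phi> S' \<subseteq> W \<union> \<tau> W S"
    "subset_expectation M p (\<lambda>W. real (card {S\<in>G. s < card (\<tau> W S)})) \<le> D"
proof -
  \<comment> \<open>The minimum is over a nonempty set, since \<open>S\<close> itself is a
    candidate.\<close>
  define \<nu> where "\<nu> W S = arg_min (\<lambda>S'. card (\<phi> S' - W)) (\<lambda>S'. S' \<in> G \<and> \<phi> S' \<subseteq> W \<union> \<phi> S)"
    for W S
  define \<tau> where "\<tau> W S = \<phi> (\<nu> W S) - W" for W S
  \<comment> \<open>The choice depends on \<open>Z\<close> alone, so it is available before
    \<open>W\<close> and \<open>T\<close> are known.\<close>
  define \<sigma> where "\<sigma> Z = (SOME S. S \<in> G \<and> \<phi> S \<subseteq> Z)" for Z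
  define Zs where "Zs = {Z. Z \<subseteq> M \<and> (\<exists>S\<in>G. \<phi> S \<subseteq> Z)}"
  have \<nu>: "\<nu> W S \<in> G" "\<phi> (\<nu> W S) \<subseteq> W \<union> \<phi> S" if "S \<in> G" for W S
    using arg_min_natI[of "\<lambda>S'. S' \<in> G \<and> \<phi> S' \<subseteq> W \<union> \<phi> S" S "\<lambda>S'. card (\<phi> S' - W)"] that
    by (auto simp: \<nu>_def)
  have minimal: "card (\<tau> W S) \<le> card (\<phi> S' - W)" if "S' \<in> G" "\<phi> S' \<subseteq> W \<union> \<phi> S" for W S S'
    unfolding \<tau>_def \<nu>_def using that by (intro arg_min_nat_le) auto
  have \<tau>_sub: "\<tau> W S \<subseteq> \<phi> S" if "S \<in> G" for W S
    using \<nu>[OF that] by (auto simp: \<tau>_def)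
  have \<nu>_sub: "\<phi> (\<nu> W S) \<subseteq> W \<union> \<tau> W S" for W S
    by (auto simp: \<tau>_def)
  have \<sigma>: "\<sigma> Z \<in> G" "\<phi> (\<sigma> Z) \<subseteq> Z" if "Z \<in> Zs" for Z
    using that someI_ex[of "\<lambda>S. S \<in> G \<and> \<phi> S \<subseteq> Z"] by (auto simp: Zs_def \<sigma>_def)
  have fin: "finite X" if "X \<subseteq> M" for X
    using that M finite_subset by auto
  have in_Zs: "W \<union> \<tau> W S \<in> Zs" if "W \<subseteq> M" "S \<in> G" for W S
    using that \<tau>_sub[OF that(2)] sub[OF that(2)] \<nu>(1)[OF that(2)] \<nu>_sub
    unfolding Zs_def by blast
  \<comment> \<open>The chosen piece lies in \<open>W \<union> \<tau> W S\<close>, hence in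
    \<open>W \<union> \<phi> S\<close>, so it competes in the minimization. Its part outside
    \<open>W\<close> is contained in the fragment and not smaller, hence equal to it.\<close>
  have \<tau>_\<sigma>: "\<tau> W S \<subseteq> \<phi> (\<sigma> (W \<union> \<tau> W S))" if "W \<subseteq> M" "S \<in> G" for W S
  proof -
    let ?A = "\<phi> (\<sigma> (W \<union> \<tau> W S)) - W"
    note s = \<sigma>[OF in_Zs[OF that]]
    have "?A \<subseteq> \<tau> W S" using s by auto
    moreover have "card (\<tau> W S) \<le> card ?A"
      using s \<tau>_sub[OF that(2)] by (intro minimal) auto
    moreover have "finite (\<tau> W S)"
      using fin \<tau>_sub[OF that(2)] sub[OF that(2)] by auto
    ultimately have "?A = \<tau> W S"
      by (intro card_seteq) auto
    then show ?thesis by auto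
  qed
  define P where "P = (SIGMA W:Pow M. {S\<in>G. s < card (\<tau> W S)})"
  define Q where "Q = (SIGMA Z:Zs. SIGMA T:{T. T \<subseteq> \<phi> (\<sigma> Z) \<and> s < card T}. {S\<in>G. T \<subseteq> \<phi> S})"
  have finT: "finite {T. T \<subseteq> \<phi> (\<sigma> Z) \<and> s < card T}" if "Z \<in> Zs" for Z
    using fin[of "\<phi> (\<sigma> Z)"] sub \<sigma>(1)[OF that] by (auto intro!: finite_subset[of _ "Pow (\<phi> (\<sigma> Z))"])
  have finZs: "finite Zs"
    using M by (auto simp: Zs_def intro!: finite_subset[of _ "Pow M"])
  have "subset_expectation M p (\<lambda>W. real (card {S\<in>G. s < card (\<tau> W S)}))
      = (\<Sum>(W, S)\<in>P. subset_weight M p W)"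
    using M G unfolding P_def subset_expectation_def
    by (subst sum.Sigma[symmetric]) (auto simp: mult.commute)
  also have "\<dots> \<le> (\<Sum>(Z, T, S)\<in>Q. subset_weight M p Z / p ^ card T)"
  \<comment> \<open>The map decodes a triple; it suffices that every pair in \<open>P\<close> has a
    code in \<open>Q\<close> of at least its weight.\<close>
  proof (rule sum_le_included[where i = "\<lambda>(Z, T, S). (Z - T, S)"])
    show "finite P" using M G by (auto simp: P_def)
    show "finite Q" using finZs finT G by (auto simp: Q_def)
    show "\<forall>y\<in>Q. 0 \<le> (case y of (Z, T, S) \<Rightarrow> subset_weight M p Z / p ^ card T)"
      using p by (auto simp: subset_weight_nonneg)
    show "\<forall>x\<in>P. \<exists>y\<in>Q. (case y of (Z, T, S) \<Rightarrow> (Z - T, S)) = x \<and>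
        (case x of (W, S) \<Rightarrow> subset_weight M p W)
          \<le> (case y of (Z, T, S) \<Rightarrow> subset_weight M p Z / p ^ card T)"
    proof (safe, goal_cases)
      case (1 W S)
      then have WS: "W \<subseteq> M" "S \<in> G" "s < card (\<tau> W S)" by (auto simp: P_def)
      let ?T = "\<tau> W S"
      have disj: "W \<inter> ?T = {}" by (auto simp: \<tau>_def)
      have TM: "?T \<subseteq> M" using \<tau>_sub[OF WS(2)] sub[OF WS(2)] by auto
      \<comment> \<open>The factor \<open>(1 - p) ^ card ?T\<close> is split off and bounded by 1
        instead of being divided by, which covers \<open>p = 1\<close>.\<close>
      have "card (M - W) = card (M - (W \<union> ?T) \<union> ?T)"
        using TM disj by (intro arg_cong[of _ _ card]) auto
      also have "\<dots> = card (M - (W \<union> ?T)) + card ?T"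
        using fin[OF TM] M by (intro card_Un_disjoint) auto
      finally have "subset_weight M p W =
          (p ^ card W * (1 - p) ^ card (M - (W \<union> ?T))) * (1 - p) ^ card ?T"
        by (simp add: subset_weight_def power_add)
      also have "\<dots> \<le> (p ^ card W * (1 - p) ^ card (M - (W \<union> ?T))) * 1"
        using p by (intro mult_left_mono power_le_one) auto
      also have "\<dots> = subset_weight M p (W \<union> ?T) / p ^ card ?T"
        using disj fin WS(1) TM p
        by (simp add: subset_weight_def card_Un_disjoint power_add field_simps)
      finally have "subset_weight M p W \<le> subset_weight M p (W \<union> ?T) / p ^ card ?T" .
      moreover have "(W \<union> ?T, ?T, S) \<in> Q"
        using WS in_Zs \<tau>_\<sigma> \<tau>_sub by (auto simp: Q_def)
      moreover have "W \<union> ?T - ?T = W" using disj by auto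
      ultimately show ?case by (intro bexI[of _ "(W \<union> ?T, ?T, S)"]) auto
    qed
  qed
  \<comment> \<open>After grouping by \<open>Z\<close>, the inner sum runs over subsets of the
    single piece \<open>\<phi> (\<sigma> Z)\<close>, so \<open>bound\<close> applies to it.\<close>
  also have "\<dots> = (\<Sum>Z\<in>Zs. subset_weight M p Z *
      (\<Sum>T | T \<subseteq> \<phi> (\<sigma> Z) \<and> s < card T. real (card {S\<in>G. T \<subseteq> \<phi> S}) / p ^ card T))"
    using finZs finT G unfolding Q_def
    by (subst sum.Sigma[symmetric], simp, force, intro sum.cong refl,
        subst sum.Sigma[symmetric], auto simp: sum_distrib_left algebra_simps)
  also have "\<dots> \<le> (\<Sum>Z\<in>Zs. subset_weight M p Z * D)"
    using p \<sigma> bound by (intro sum_mono mult_left_mono) (auto simp: subset_weight_nonneg)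
  also have "\<dots> \<le> (\<Sum>Z\<in>Pow M. subset_weight M p Z * D)"
    using M p D by (intro sum_mono2) (auto simp: Zs_def subset_weight_nonneg)
  also have "\<dots> = D"
    using subset_expectation_const[OF M, of p D] by (simp add: subset_expectation_def)
  finally have "subset_expectation M p (\<lambda>W. real (card {S\<in>G. s < card (\<tau> W S)})) \<le> D" .
  then show thesis
    using \<tau>_sub \<nu>_sub \<nu>(1) by (intro that[of \<tau>]) blast+
qed

section \<open>Iteration over independent rounds\<close>

text \<open>There remain \<open>Suc j\<close> rounds of rate \<open>p\<^sub>0\<close>, and at least
  the fraction \<open>1 / 2 ^ i\<close> of \<open>H\<close> has survived. By Markov's inequality a
  round destroys half of \<open>G\<close> or more with probability at most
  \<open>2 ^ Suc i * \<eta>\<close>; otherwise the surviving copies with their fragments form the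
  next instance, so \<open>G\<close>, \<open>\<phi>\<close>, \<open>i\<close> and \<open>p\<close>
  all vary in the induction.\<close>

lemma iterated_fragments:
  fixes H :: "'a set set"
  assumes M: "finite M" and HM: "\<And>S. S \<in> H \<Longrightarrow> S \<subseteq> M"
    and p0: "0 < p\<^sub>0" and x: "0 < x" and \<eta>: "0 \<le> \<eta>"
    and bound: "\<And>A S s. S \<in> H \<Longrightarrow> A \<subseteq> S \<Longrightarrow> x * real (card A) \<le> real s + 1 \<Longrightarrow>
      (\<Sum>T | T \<subseteq> A \<and> s < card T. real (card {S'\<in>H. T \<subseteq> S'}) / p\<^sub>0 ^ card T) \<le> \<eta> * real (card H)"
    and "G \<subseteq> H" and "G \<noteq> {}" and "real (card H) \<le> 2 ^ i * real (card G)"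
    and "\<And>S. S \<in> G \<Longrightarrow> \<phi> S \<subseteq> S" and "\<And>S. S \<in> G \<Longrightarrow> real (card (\<phi> S)) * x ^ Suc j \<le> 1"
    and "real (Suc j) * p\<^sub>0 \<le> p" and "p \<le> 1"
  shows "subset_expectation M p (\<lambda>W. of_bool (\<not> (\<exists>S\<in>G. \<phi> S \<subseteq> W))) \<le> real (Suc j) * 2 ^ (i + j) * \<eta>"
  using assms(7-)
proof (induction j arbitrary: G \<phi> i p)
  have H: "finite H"
    using M HM by (auto intro!: finite_subset[of H "Pow M"])
  \<comment> \<open>Replacing pieces by copies, \<open>G\<close> by \<open>H\<close> and
    \<open>p\<close> by \<open>p\<^sub>0\<close> only increases the fragment sum, so the one
    hypothesis \<open>bound\<close> serves every round.\<close>
  have step: "\<exists>\<tau>. (\<forall>W S. W \<subseteq> M \<longrightarrow> S \<in> G \<longrightarrow> \<tau> W S \<subseteq> \<phi> S) \<and>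
      (\<forall>W S. W \<subseteq> M \<longrightarrow> S \<in> G \<longrightarrow> (\<exists>S'\<in>G. \<phi> S' \<subseteq> W \<union> \<tau> W S)) \<and>
      subset_expectation M p (\<lambda>W. real (card {S\<in>G. s < card (\<tau> W S)})) \<le> \<eta> * real (card H)"
    if "G \<subseteq> H" and step_prems: "\<And>S. S \<in> G \<Longrightarrow> \<phi> S \<subseteq> S"
      "\<And>S. S \<in> G \<Longrightarrow> x * real (card (\<phi> S)) \<le> real s + 1"
      and "p\<^sub>0 \<le> p" "p \<le> 1" for G \<phi> p s
  proof -
    have GM: "\<phi> S \<subseteq> M" if "S \<in> G" for S
      using that \<open>G \<subseteq> H\<close> HM step_prems(1) by blast
    have "(\<Sum>T | T \<subseteq> \<phi> S \<and> s < card T. real (card {S'\<in>G. T \<subseteq> \<phi> S'}) / p ^ card T)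
        \<le> \<eta> * real (card H)" if "S \<in> G" for S
    proof -
      have "(\<Sum>T | T \<subseteq> \<phi> S \<and> s < card T. real (card {S'\<in>G. T \<subseteq> \<phi> S'}) / p ^ card T)
          \<le> (\<Sum>T | T \<subseteq> \<phi> S \<and> s < card T. real (card {S'\<in>H. T \<subseteq> S'}) / p\<^sub>0 ^ card T)"
      proof (intro sum_mono frac_le)
        fix T
        show "real (card {S'\<in>G. T \<subseteq> \<phi> S'}) \<le> real (card {S'\<in>H. T \<subseteq> S'})"
          unfolding of_nat_le_iff using H \<open>G \<subseteq> H\<close> step_prems(1)
          by (intro card_mono) auto
        show "p\<^sub>0 ^ card T \<le> p ^ card T" using p0 \<open>p\<^sub>0 \<le> p\<close> by (intro power_mono) auto
      qed (use p0 in auto)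
      also have "\<dots> \<le> \<eta> * real (card H)"
        using \<open>S \<in> G\<close> \<open>G \<subseteq> H\<close> by (intro bound[of S] step_prems) auto
      finally show ?thesis .
    qed
    then show ?thesis
      using minimum_fragment[of M G p "\<eta> * real (card H)" \<phi> s] M H \<eta> GM p0 that
      by (smt (verit, best) finite_subset mult_nonneg_nonneg of_nat_0_le_iff)
  qed
  {
    case (0 G \<phi> i p)
    \<comment> \<open>The last round has threshold 0: a fragment that is not large is empty, and
      then some piece lies in \<open>W\<close>. On failure every copy in \<open>G\<close> therefore
      has a large fragment.\<close>
    have "\<And>S. S \<in> G \<Longrightarrow> x * real (card (\<phi> S)) \<le> real 0 + 1"
      using 0(5) by (simp add: mult.commute)
    then obtain \<tau> where \<tau>[rule_format]: "\<forall>W S. W \<subseteq> M \<longrightarrow> S \<in> G \<longrightarrow> \<tau> W S \<subseteq> \<phi> S"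
      "\<forall>W S. W \<subseteq> M \<longrightarrow> S \<in> G \<longrightarrow> (\<exists>S'\<in>G. \<phi> S' \<subseteq> W \<union> \<tau> W S)"
      "subset_expectation M p (\<lambda>W. real (card {S\<in>G. 0 < card (\<tau> W S)})) \<le> \<eta> * real (card H)"
      using step[of G \<phi> 0 p] 0 by (auto simp del: card_gt_0_iff)
    have fG: "finite G" "0 < card G"
      using 0 H finite_subset by (auto simp: card_gt_0_iff)
    \<comment> \<open>The summand \<open>0 * 0\<close> gives the integrand the shape of
      \<open>subset_expectation_linear\<close>.\<close>
    have "real (card G) * subset_expectation M p (\<lambda>W. of_bool (\<not> (\<exists>S\<in>G. \<phi> S \<subseteq> W)))
        = subset_expectation M p (\<lambda>W. real (card G) * of_bool (\<not> (\<exists>S\<in>G. \<phi> S \<subseteq> W)) + 0 * 0)"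
      by (simp only: subset_expectation_linear)
    also have "\<dots> \<le> subset_expectation M p (\<lambda>W. real (card {S\<in>G. 0 < card (\<tau> W S)}))"
    proof (rule subset_expectation_mono)
      fix W assume W: "W \<subseteq> M"
      have "{S\<in>G. 0 < card (\<tau> W S)} = G" if "\<not> (\<exists>S\<in>G. \<phi> S \<subseteq> W)"
      proof -
        have "finite (\<tau> W S)" if "S \<in> G" for S
        proof -
          have "\<tau> W S \<subseteq> S" using \<tau>(1)[OF W that] 0(4)[OF that] by (rule subset_trans)
          then have "\<tau> W S \<subseteq> M" using HM 0(1) that by blast
          then show ?thesis using M by (rule finite_subset)
        qed
        moreover have "\<tau> W S \<noteq> {}" if "S \<in> G" for S
          using \<tau>(2)[OF W that] \<open>\<not> (\<exists>S\<in>G. \<phi> S \<subseteq> W)\<close> by force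
        ultimately show ?thesis by (auto simp: card_gt_0_iff)
      qed
      then show "real (card G) * of_bool (\<not> (\<exists>S\<in>G. \<phi> S \<subseteq> W)) + 0 * 0
          \<le> real (card {S\<in>G. 0 < card (\<tau> W S)})"
        by auto
    qed (use 0 p0 in auto)
    also have "\<dots> \<le> \<eta> * (2 ^ i * real (card G))"
      using \<tau>(3) 0(3) \<eta> by (meson mult_left_mono order_trans)
    finally show ?case using fG by (simp add: field_simps)
  next
    case (Suc j G \<phi> i p)
    have fG: "finite G" "0 < card G"
      using Suc.prems H finite_subset by (auto simp: card_gt_0_iff)
    \<comment> \<open>Fragments of size at most \<open>s\<close> meet the size condition of the next
      round, and \<open>s + 1\<close> still exceeds \<open>x\<close> times the present size; the
      rounding is why \<open>bound\<close> allows \<open>s + 1\<close>.\<close>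
    define s where "s = nat \<lfloor>1 / x ^ Suc j\<rfloor>"
    have s: "1 / x ^ Suc j \<le> real s + 1" "real s \<le> 1 / x ^ Suc j"
      using x unfolding s_def by (auto; linarith)+
    have "0 \<le> real j * p\<^sub>0" using p0 by simp
    moreover have "real (Suc (Suc j)) * p\<^sub>0 = real j * p\<^sub>0 + 2 * p\<^sub>0" by (simp add: algebra_simps)
    ultimately have p1: "p\<^sub>0 < p" using Suc.prems(6) p0 by linarith
    \<comment> \<open>The rate left after one round of rate \<open>p\<^sub>0\<close>. It is at least
      \<open>p - p\<^sub>0\<close>, enough for the other \<open>Suc j\<close> rounds.\<close>
    define t where "t = (p - p\<^sub>0) / (1 - p\<^sub>0)"
    have "p\<^sub>0 < 1" using p1 Suc.prems(7) by auto
    have t1: "t \<le> 1" using \<open>p\<^sub>0 < 1\<close> Suc.prems(7) by (simp add: t_def)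
    have "(p - p\<^sub>0) / 1 \<le> t" unfolding t_def using p0 p1 \<open>p\<^sub>0 < 1\<close> by (intro divide_left_mono) auto
    then have t0: "real (Suc j) * p\<^sub>0 \<le> t" using Suc.prems(6) by (simp add: algebra_simps)
    have p_eq: "p = 1 - (1 - p\<^sub>0) * (1 - t)"
      using \<open>p\<^sub>0 < 1\<close> by (simp add: t_def field_simps)
    have t_nonneg: "0 \<le> t" using t0 p0 by (smt (verit) mult_nonneg_nonneg of_nat_0_le_iff)
    have sz: "x * real (card (\<phi> S)) \<le> real s + 1" if "S \<in> G" for S
    proof -
      have "x * real (card (\<phi> S)) \<le> 1 / x ^ Suc j"
        using Suc.prems(5)[OF that] x by (simp add: field_simps)
      then show ?thesis using s(1) by linarith
    qed
    obtain \<tau> where \<tau>[rule_format]: "\<forall>W S. W \<subseteq> M \<longrightarrow> S \<in> G \<longrightarrow> \<tau> W S \<subseteq> \<phi> S"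
      "\<forall>W S. W \<subseteq> M \<longrightarrow> S \<in> G \<longrightarrow> (\<exists>S'\<in>G. \<phi> S' \<subseteq> W \<union> \<tau> W S)"
      "subset_expectation M p\<^sub>0 (\<lambda>W. real (card {S\<in>G. s < card (\<tau> W S)})) \<le> \<eta> * real (card H)"
      using step[OF Suc.prems(1,4) sz, of p\<^sub>0] \<open>p\<^sub>0 < 1\<close> by (auto simp: less_imp_le)
    define a where "a = real (Suc j) * 2 ^ (Suc i + j) * \<eta>"
    have a: "0 \<le> a" using \<eta> by (simp add: a_def)
    let ?bad = "\<lambda>W. {S\<in>G. s < card (\<tau> W S)}"
    have "subset_expectation M p (\<lambda>W. of_bool (\<not> (\<exists>S\<in>G. \<phi> S \<subseteq> W))) =
        subset_expectation M p\<^sub>0 (\<lambda>V. subset_expectation M t (\<lambda>W. of_bool (\<not> (\<exists>S\<in>G. \<phi> S \<subseteq> V \<union> W))))"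
      unfolding p_eq by (rule subset_expectation_union[OF M])
    \<comment> \<open>If at least half of \<open>G\<close> is bad, the first summand is at least 1.
      Otherwise the induction hypothesis with \<open>Suc i\<close> gives \<open>a\<close>.\<close>
    also have "\<dots> \<le> subset_expectation M p\<^sub>0 (\<lambda>V. (2 / real (card G)) * real (card (?bad V)) + a * 1)"
    proof (rule subset_expectation_mono)
      fix V assume V: "V \<subseteq> M"
      show "subset_expectation M t (\<lambda>W. of_bool (\<not> (\<exists>S\<in>G. \<phi> S \<subseteq> V \<union> W)))
          \<le> (2 / real (card G)) * real (card (?bad V)) + a * 1"
      proof (cases "real (card G) \<le> 2 * real (card (?bad V))")
        case True
        have "subset_expectation M t (\<lambda>W. of_bool (\<not> (\<exists>S\<in>G. \<phi> S \<subseteq> V \<union> W)))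
            \<le> subset_expectation M t (\<lambda>W. 1)"
          using t_nonneg t1 by (intro subset_expectation_mono) auto
        also have "\<dots> = 1" by (rule subset_expectation_const[OF M])
        also have "\<dots> \<le> (2 / real (card G)) * real (card (?bad V)) + a * 1"
          using True fG a by (simp add: field_simps add_increasing)
        finally show ?thesis .
      next
        case False
        define G' where "G' = G - ?bad V"
        have "card (?bad V) \<le> card G" using fG by (intro card_mono) auto
        then have cG': "real (card G') = real (card G) - real (card (?bad V))"
          unfolding G'_def using fG by (subst card_Diff_subset) auto
        \<comment> \<open>A fragment found in the later rounds completes, together with
          \<open>V\<close>, some old piece, possibly of another copy.\<close>
        have "subset_expectation M t (\<lambda>W. of_bool (\<not> (\<exists>S\<in>G. \<phi> S \<subseteq> V \<union> W)))
            \<le> subset_expectation M t (\<lambda>W. of_bool (\<not> (\<exists>S\<in>G'. \<tau> V S \<subseteq> W)))"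
        proof (rule subset_expectation_mono)
          fix W
          have "\<exists>S\<in>G. \<phi> S \<subseteq> V \<union> W" if "S \<in> G'" "\<tau> V S \<subseteq> W" for S
            using \<tau>(2)[OF V, of S] that by (auto simp: G'_def)
          then show "of_bool (\<not> (\<exists>S\<in>G. \<phi> S \<subseteq> V \<union> W))
              \<le> (of_bool (\<not> (\<exists>S\<in>G'. \<tau> V S \<subseteq> W)) :: real)"
            by auto
        qed (use t_nonneg t1 in auto)
        also have "\<dots> \<le> a"
          unfolding a_def
        proof (rule Suc.IH)
          show "G' \<subseteq> H" using Suc.prems(1) by (auto simp: G'_def)
          have "0 < real (card G')" using cG' False by linarith
          then show "G' \<noteq> {}" by auto
          have "real (card G) \<le> 2 * real (card G')" using cG' False by linarith
          then have "2 ^ i * real (card G) \<le> 2 ^ i * (2 * real (card G'))" by simp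
          also have "\<dots> = 2 ^ Suc i * real (card G')" by simp
          finally show "real (card H) \<le> 2 ^ Suc i * real (card G')"
            using Suc.prems(3) by (rule order_trans[rotated])
          show "\<tau> V S \<subseteq> S" if "S \<in> G'" for S
            using \<tau>(1)[OF V, of S] Suc.prems(4)[of S] that by (auto simp: G'_def)
          show "real (card (\<tau> V S)) * x ^ Suc j \<le> 1" if "S \<in> G'" for S
          proof -
            have "real (card (\<tau> V S)) \<le> 1 / x ^ Suc j"
              using that s(2) by (auto simp: G'_def)
            then show ?thesis using x by (simp add: field_simps)
          qed
        qed (use t0 t1 in auto)
        also have "\<dots> \<le> (2 / real (card G)) * real (card (?bad V)) + a * 1" by simp
        finally show ?thesis .
      qed
    qed (use p0 \<open>p\<^sub>0 < 1\<close> in auto)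
    also have "\<dots> = 2 / real (card G) * subset_expectation M p\<^sub>0 (\<lambda>V. real (card (?bad V))) + a"
      unfolding subset_expectation_linear subset_expectation_const[OF M] by simp
    also have "\<dots> \<le> 2 / real (card G) * (\<eta> * (2 ^ i * real (card G))) + a"
      using order_trans[OF \<tau>(3) mult_left_mono[OF Suc.prems(3) \<eta>]]
      by (intro add_right_mono mult_left_mono) auto
    also have "\<dots> = 2 ^ Suc i * \<eta> + a" using Suc.prems(2) fG(1) by simp
    \<comment> \<open>The loss of this round is rounded up to
      \<open>2 ^ (i + Suc j) * \<eta>\<close>, of which \<open>a\<close> contains
      \<open>Suc j\<close> multiples.\<close>
    also have "\<dots> \<le> 2 ^ (i + Suc j) * \<eta> + a"
      using \<eta> by (intro add_right_mono mult_right_mono power_increasing) auto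
    also have "\<dots> = real (Suc (Suc j)) * 2 ^ (i + Suc j) * \<eta>"
      by (simp add: a_def algebra_simps)
    finally show ?case .
  }
qed

section \<open>Counting subgraphs by components\<close>

text \<open>The components that an exploration having reached \<open>U\<close> has not yet met; for
  \<open>U = {}\<close> their number is \<open>num_components T\<close>.\<close>

definition components_avoiding :: "'v set \<Rightarrow> 'v set set \<Rightarrow> 'v set set" where
  "components_avoiding U T = {X \<in> \<Union>T // connected_rel T. X \<inter> U = {}}"

lemma connected_rel_Image:
  "v \<in> \<Union>T \<Longrightarrow> connected_rel T `` {v} = {w \<in> \<Union>T. (v, w) \<in> {(x, y). {x, y} \<in> T}\<^sup>*}"
  by (auto simp: connected_rel_def)

lemma finite_components_avoiding:
  assumes "finite (\<Union>T)"
  shows "finite (components_avoiding U T)"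
proof (rule finite_subset)
  show "components_avoiding U T \<subseteq> (\<lambda>v. connected_rel T `` {v}) ` \<Union>T"
    by (auto simp: components_avoiding_def quotient_def)
qed (use assms in simp)

text \<open>A path starting in \<open>X\<close> can use \<open>e\<close> only from a vertex of
  \<open>X\<close> in \<open>e\<close>, and there is none.\<close>

lemma component_of_insert:
  assumes X: "X \<in> \<Union>T // connected_rel T" and e: "X \<inter> e = {}"
  shows "X \<in> \<Union>(insert e T) // connected_rel (insert e T)"
proof -
  let ?R = "\<lambda>E. {(x, y). {x, y} \<in> E}"
  obtain v where v: "v \<in> \<Union>T" "X = connected_rel T `` {v}"
    using X by (auto simp: quotient_def)
  note Xv = v(2)[unfolded connected_rel_Image[OF v(1)]]
  have "w \<in> X" if "(v, w) \<in> (?R (insert e T))\<^sup>*" for w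
    using that
  proof (induction rule: rtrancl_induct)
    case base
    then show ?case using v Xv by auto
  next
    case (step y z)
    then have "{y, z} \<in> T" using e by auto
    then show ?case using step.IH unfolding Xv by (auto intro: rtrancl_into_rtrancl)
  qed
  moreover have "(?R T)\<^sup>* \<subseteq> (?R (insert e T))\<^sup>*"
    by (rule rtrancl_mono) auto
  ultimately have "X = connected_rel (insert e T) `` {v}"
    using v(1) by (subst connected_rel_Image) (auto simp: Xv)
  then show ?thesis using v(1) by (auto simp: quotient_def)
qed

text \<open>Adding \<open>e\<close> changes only components that meet \<open>e\<close>, and the left
  side excludes these.\<close>

lemma components_avoiding_insert:
  "components_avoiding (U \<union> e) T \<subseteq> components_avoiding U (insert e T)"
  using component_of_insert[of _ T e] by (auto simp: components_avoiding_def)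

text \<open>The component of \<open>e\<close> is the extra one: it meets \<open>e\<close>, and it
  avoids \<open>U\<close> because no edge touches \<open>U\<close>.\<close>

lemma card_components_avoiding_insert_isolated:
  assumes fin: "finite (\<Union>(insert e T))" and e: "e \<noteq> {}"
    and U: "\<And>f. f \<in> insert e T \<Longrightarrow> f \<inter> U = {}"
  shows "Suc (card (components_avoiding (U \<union> e) T)) \<le> card (components_avoiding U (insert e T))"
proof -
  obtain v where v: "v \<in> e" using e by auto
  define X where "X = connected_rel (insert e T) `` {v}"
  have "v \<in> X" using v by (auto simp: X_def connected_rel_def)
  then have "X \<notin> components_avoiding (U \<union> e) T"
    using v by (auto simp: components_avoiding_def)
  have "X \<subseteq> \<Union>(insert e T)" by (auto simp: X_def connected_rel_def)
  then have "X \<inter> U = {}" using U by blast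
  then have "X \<in> components_avoiding U (insert e T)"
    using v by (auto simp: components_avoiding_def quotient_def X_def)
  moreover have "finite (components_avoiding (U \<union> e) T)"
    using fin by (intro finite_components_avoiding) auto
  ultimately show ?thesis
    using \<open>X \<notin> _\<close> components_avoiding_insert[of U e T] finite_components_avoiding[OF fin, of U]
      card_mono[of "components_avoiding U (insert e T)" "insert X (components_avoiding (U \<union> e) T)"]
    by auto
qed

text \<open>
  Exploring the component structure edge by edge: \<open>U\<close> is the set of vertices already reached. Including
  an edge costs a factor \<open>x\<close> only if it does not touch \<open>U\<close>.
\<close>

lemma component_sum_bound:
  fixes x :: real
  assumes "finite A" "\<And>e. e \<in> A \<Longrightarrow> card e = 2" "\<And>v. vertex_degree A v \<le> D"
    and x: "0 \<le> x" "x \<le> 1"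
  shows "(\<Sum>T\<in>Pow A. (1 / 4 ^ D) ^ card T * x ^ card (components_avoiding U T))
    \<le> (1 + x) ^ card A * 2 ^ card {e\<in>A. e \<inter> U \<noteq> {}}"
  using assms(1-3)
proof (induction "card A" arbitrary: A U)
  case 0
  then show ?case by (simp add: components_avoiding_def)
next
  case (Suc m)
  define w where "w U A = (\<Sum>T\<in>Pow A. (1 / 4 ^ D :: real) ^ card T * x ^ card (components_avoiding U T))"
    for U :: "'a set" and A
  let ?f = "\<lambda>U A. card {e\<in>A. e \<inter> U \<noteq> {}}"
  have degree_mono: "vertex_degree A' v \<le> D" if "A' \<subseteq> A" for A' v
  proof -
    have "vertex_degree A' v \<le> vertex_degree A v"
      unfolding vertex_degree_def using that Suc.prems(1) by (intro card_mono) auto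
    then show ?thesis using Suc.prems(3)[of v] by linarith
  qed
  have IH: "w U (A - {e}) \<le> (1 + x) ^ m * 2 ^ ?f U (A - {e})" if "e \<in> A" for U e
    unfolding w_def
    by (rule Suc.hyps(1)[of "A - {e}" U, THEN order_trans])
      (use Suc.hyps(2)[symmetric] Suc.prems that degree_mono in auto)
  have finU: "finite (\<Union>T)" if "T \<subseteq> A" for T
    using that Suc.prems(1,2)
    by (intro finite_Union finite_subset[OF that]) (auto intro!: card_ge_0_finite)
  have split: "w U A = w U (A - {e}) +
      (\<Sum>T\<in>Pow (A - {e}). (1 / 4 ^ D) ^ Suc (card T) * x ^ card (components_avoiding U (insert e T)))"
    if "e \<in> A" for e U
  proof -
    have "(1 / 4 ^ D :: real) ^ card (insert e T) = (1 / 4 ^ D) ^ Suc (card T)" if "T \<in> Pow (A - {e})" for T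
      using that Suc.prems(1) finite_subset[of T A]
      by (subst card_insert_disjoint) auto
    moreover have "A = insert e (A - {e})" using that by auto
    ultimately show ?thesis
      using Suc.prems(1) sum_Pow_insert[of "A - {e}" e] unfolding w_def
      by (smt (verit, best) finite_Diff insert_Diff_single Diff_iff insertI1 sum.cong)
  qed
  have edge_vertices: "?f (U \<union> {v}) A' \<le> ?f U A' + D" if "A' \<subseteq> A" for U A' v
  proof -
    have fin: "finite A'" using that Suc.prems(1) finite_subset by auto
    have "?f (U \<union> {v}) A' \<le> card ({e\<in>A'. e \<inter> U \<noteq> {}} \<union> {e\<in>A'. v \<in> e})"
      using fin by (intro card_mono) auto
    also have "\<dots> \<le> ?f U A' + vertex_degree A' v"
      unfolding vertex_degree_def by (rule card_Un_le)
    finally show ?thesis using degree_mono[OF that, of v] by linarith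
  qed
  show ?case
    unfolding w_def[symmetric]
  proof (cases "\<exists>e\<in>A. e \<inter> U \<noteq> {}")
    \<comment> \<open>When \<open>e\<close> is removed, one edge fewer touches \<open>U\<close>,
      which frees a factor 2. Including \<open>e\<close> costs \<open>1 / 4 ^ D\<close> and reaches
      one new vertex, hence at most \<open>D\<close> more touching edges. Since
      \<open>2 ^ D / 4 ^ D \<le> 1\<close>, both options together cost at most 2.\<close>
    case True
    then obtain e u where e: "e \<in> A" "u \<in> e" "u \<in> U" by auto
    have "card e = 2" using e Suc.prems(2) by auto
    then obtain v where ev: "e = {u, v}" using e(2) by (auto simp: card_2_iff)
    have "{e\<in>A. e \<inter> U \<noteq> {}} = insert e {e'\<in>A - {e}. e' \<inter> U \<noteq> {}}"
      using e by auto
    then have f: "?f U A = Suc (?f U (A - {e}))"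
      using Suc.prems(1) by simp
    have "U \<union> e = U \<union> {v}" using ev e by auto
    then have f2: "?f (U \<union> e) (A - {e}) \<le> ?f U (A - {e}) + D"
      using edge_vertices[of "A - {e}" U v] by auto
    have "w U A \<le> w U (A - {e}) + (1 / 4 ^ D) * w (U \<union> e) (A - {e})"
      unfolding split[OF e(1)] w_def[of "U \<union> e"] sum_distrib_left
    proof (intro add_left_mono sum_mono)
      fix T assume T: "T \<in> Pow (A - {e})"
      have "card (components_avoiding (U \<union> e) T) \<le> card (components_avoiding U (insert e T))"
        using T e by (intro card_mono components_avoiding_insert finite_components_avoiding finU) auto
      then have "x ^ card (components_avoiding U (insert e T)) \<le> x ^ card (components_avoiding (U \<union> e) T)"
        using x by (intro power_decreasing) auto
      then show "(1 / 4 ^ D) ^ Suc (card T) * x ^ card (components_avoiding U (insert e T))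
          \<le> 1 / 4 ^ D * ((1 / 4 ^ D) ^ card T * x ^ card (components_avoiding (U \<union> e) T))"
        by (simp add: divide_right_mono)
    qed
    also have "\<dots> \<le> (1 + x) ^ m * 2 ^ ?f U (A - {e}) + (1 / 4 ^ D) * ((1 + x) ^ m * 2 ^ (?f U (A - {e}) + D))"
    proof (intro add_mono mult_left_mono IH e)
      have "w (U \<union> e) (A - {e}) \<le> (1 + x) ^ m * 2 ^ ?f (U \<union> e) (A - {e})" by (rule IH[OF e(1)])
      also have "\<dots> \<le> (1 + x) ^ m * 2 ^ (?f U (A - {e}) + D)"
        using f2 x by (intro mult_left_mono power_increasing) auto
      finally show "w (U \<union> e) (A - {e}) \<le> (1 + x) ^ m * 2 ^ (?f U (A - {e}) + D)" .
    qed auto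
    also have "\<dots> = (1 + x) ^ m * 2 ^ ?f U (A - {e}) * (1 + 2 ^ D / 4 ^ D)"
      by (simp add: power_add field_simps)
    also have "\<dots> \<le> (1 + x) ^ m * 2 ^ ?f U (A - {e}) * 2"
      using x by (intro mult_left_mono) (auto simp: power_mono)
    also have "\<dots> = (1 + x) ^ m * 2 ^ ?f U A" unfolding f by simp
    also have "\<dots> \<le> (1 + x) ^ card A * 2 ^ ?f U A"
      using x Suc.hyps(2) by (intro mult_right_mono power_increasing) auto
    finally show "w U A \<le> (1 + x) ^ card A * 2 ^ ?f U A" .
  next
    \<comment> \<open>Including \<open>e\<close> pays \<open>x\<close> for its component. Its two
      ends give at most \<open>2 * D\<close> touching edges, whose factor \<open>2 ^ (2 * D)\<close>
      cancels \<open>1 / 4 ^ D\<close> exactly; this explains the base 4 and leaves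
      \<open>1 + x\<close>.\<close>
    case False
    then have f: "?f U A' = 0" if "A' \<subseteq> A" for A'
      using that by (auto simp: card_eq_0_iff)
    obtain e where e: "e \<in> A" using Suc.hyps(2) by fastforce
    have "card e = 2" using e Suc.prems(2) by auto
    then obtain u v where ev: "e = {u, v}" by (auto simp: card_2_iff)
    have "U \<union> e = U \<union> {u} \<union> {v}" using ev by auto
    then have f2: "?f (U \<union> e) (A - {e}) \<le> 2 * D"
      using edge_vertices[of "A - {e}" "U \<union> {u}" v] edge_vertices[of "A - {e}" U u] f[of "A - {e}"]
      by auto
    have "w U A \<le> w U (A - {e}) + (x / 4 ^ D) * w (U \<union> e) (A - {e})"
      unfolding split[OF e(1)] w_def[of "U \<union> e"] sum_distrib_left
    proof (intro add_left_mono sum_mono)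
      fix T assume T: "T \<in> Pow (A - {e})"
      have "Suc (card (components_avoiding (U \<union> e) T)) \<le> card (components_avoiding U (insert e T))"
        using T e False ev by (intro card_components_avoiding_insert_isolated finU) auto
      then have "x ^ card (components_avoiding U (insert e T))
          \<le> x ^ Suc (card (components_avoiding (U \<union> e) T))"
        using x by (intro power_decreasing) auto
      then show "(1 / 4 ^ D) ^ Suc (card T) * x ^ card (components_avoiding U (insert e T))
          \<le> x / 4 ^ D * ((1 / 4 ^ D) ^ card T * x ^ card (components_avoiding (U \<union> e) T))"
        by (simp add: field_simps)
    qed
    also have "\<dots> \<le> (1 + x) ^ m * 2 ^ 0 + (x / 4 ^ D) * ((1 + x) ^ m * 2 ^ (2 * D))"
    proof (intro add_mono mult_left_mono)
      show "w U (A - {e}) \<le> (1 + x) ^ m * 2 ^ 0" using IH[OF e, of U] f[of "A - {e}"] by auto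
      have "w (U \<union> e) (A - {e}) \<le> (1 + x) ^ m * 2 ^ ?f (U \<union> e) (A - {e})" by (rule IH[OF e(1)])
      also have "\<dots> \<le> (1 + x) ^ m * 2 ^ (2 * D)"
        using f2 x by (intro mult_left_mono power_increasing) auto
      finally show "w (U \<union> e) (A - {e}) \<le> (1 + x) ^ m * 2 ^ (2 * D)" .
    qed (use x in auto)
    also have "\<dots> = (1 + x) ^ card A"
    proof -
      have "(2::real) ^ (2 * D) = 4 ^ D" by (simp add: power_mult)
      then show ?thesis unfolding Suc.hyps(2)[symmetric] by (simp add: field_simps)
    qed
    finally show "w U A \<le> (1 + x) ^ card A * 2 ^ ?f U A" using f[of A] by simp
  qed
qed

section \<open>Fragment sums under superspreadness\<close>

text \<open>The sets \<open>T\<close> are split at size \<open>\<delta> * k\<close>. Below it the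
  component factor and the first lower bound on \<open>B\<close> are used, above it plain spreadness
  and the second; each part contributes at most half of the bound.\<close>

lemma superspread_sum_bound:
  fixes H :: "'v set set set"
  assumes ss: "superspread M k q \<alpha> \<delta> H" and M: "finite M"
    and S: "S \<subseteq> M" "card S = k" "\<And>e. e \<in> S \<Longrightarrow> card e = 2" "\<And>v. vertex_degree S v \<le> D"
    and k: "0 < k" and \<eta>: "0 < \<eta>" "\<eta> \<le> 1"
    and B: "2 * exp 1 * 4 ^ D / \<eta> \<le> B" "2 * 2 powr (1 / \<delta>) / \<eta> \<le> B"
    and A: "A \<subseteq> S" "real k powr (-\<alpha>) * real (card A) \<le> real s + 1"
  shows "(\<Sum>T | T \<subseteq> A \<and> s < card T. real (card {S'\<in>H. T \<subseteq> S'}) / (B * q) ^ card T)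
    \<le> \<eta> * real (card H)"
proof -
  define x where "x = real k powr (-\<alpha>)"
  have q: "0 < q" and \<alpha>: "0 < \<alpha>" and \<delta>: "0 < \<delta>" using ss by (auto simp: superspread_def)
  have x: "0 \<le> x" "x \<le> 1"
    using k \<alpha> powr_mono[of "-\<alpha>" 0 "real k"] by (auto simp: x_def)
  have finS: "finite S" using S(1) M finite_subset by auto
  have finA: "finite A" using A(1) finS finite_subset by auto
  have B0: "0 < B" using B(1) \<eta> by (smt (verit) divide_pos_pos exp_gt_zero mult_pos_pos zero_less_power)
  have eB: "exp 1 * 4 ^ D / B \<le> \<eta> / 2" using B(1) B0 \<eta> by (simp add: field_simps)
  have "4 ^ D / B \<le> exp 1 * 4 ^ D / B"
    using B0 by (intro divide_right_mono) auto
  then have r: "4 ^ D / B \<le> 1" using eB \<eta> by linarith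
  have degA: "vertex_degree A v \<le> D" for v
  proof -
    have "vertex_degree A v \<le> vertex_degree S v"
      unfolding vertex_degree_def using A finS by (intro card_mono) auto
    then show ?thesis using S(4)[of v] by linarith
  qed
  let ?c = "\<lambda>T. card (components_avoiding {} T)"
  \<comment> \<open>Both cases share one bound, so that the sum separates. Of
    \<open>1 / B ^ card T\<close>, the part \<open>(1 / 4 ^ D) ^ card T\<close> feeds the component
    count, and the rest is at most \<open>(4 ^ D / B) ^ Suc s\<close> as
    \<open>s < card T\<close>.\<close>
  have term_bound: "real (card {S'\<in>H. T \<subseteq> S'}) / (B * q) ^ card T \<le>
      real (card H) * ((1 / 4 ^ D) ^ card T * x ^ ?c T * (4 ^ D / B) ^ Suc s + \<eta> / 2 / 2 ^ k)"
    if T: "T \<subseteq> A" "s < card T" for T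
  proof (cases "real (card T) \<le> \<delta> * real k")
    case True
    have "real (card {S'\<in>H. T \<subseteq> S'}) \<le> q ^ card T * x ^ num_components T * real (card H)"
      using ss True T A(1) S(1) by (auto simp: superspread_def members_containing_def x_def)
    then have "real (card {S'\<in>H. T \<subseteq> S'}) / (B * q) ^ card T
        \<le> q ^ card T * x ^ num_components T * real (card H) / (B * q) ^ card T"
      using B0 q by (intro divide_right_mono) auto
    also have "\<dots> = real (card H) * ((1 / 4 ^ D) ^ card T * x ^ ?c T * (4 ^ D / B) ^ card T)"
      using B0 q
      by (simp add: num_components_def components_avoiding_def power_mult_distrib power_divide field_simps)
    also have "\<dots> \<le> real (card H) * ((1 / 4 ^ D) ^ card T * x ^ ?c T * (4 ^ D / B) ^ Suc s)"
      using x r B0 T(2) by (intro mult_left_mono power_decreasing) auto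
    also have "\<dots> \<le> real (card H) *
        ((1 / 4 ^ D) ^ card T * x ^ ?c T * (4 ^ D / B) ^ Suc s + \<eta> / 2 / 2 ^ k)"
      using \<eta> by (intro mult_left_mono) auto
    finally show ?thesis .
  next
    case False
    have "real (card {S'\<in>H. T \<subseteq> S'}) \<le> q ^ card T * real (card H)"
      using ss T A(1) S(1) by (auto simp: superspread_def spread_def members_containing_def)
    then have "real (card {S'\<in>H. T \<subseteq> S'}) / (B * q) ^ card T
        \<le> q ^ card T * real (card H) / (B * q) ^ card T"
      using B0 q by (intro divide_right_mono) auto
    also have "\<dots> = real (card H) / B ^ card T"
      using B0 q by (simp add: power_mult_distrib)
    \<comment> \<open>Here \<open>k < card T / \<delta>\<close>, so \<open>B ^ card T\<close>
      outweighs the \<open>2 ^ k\<close> subsets of a copy; since \<open>card T\<close> is positive,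
      a factor \<open>2 / \<eta>\<close> is left.\<close>
    also have "\<dots> \<le> real (card H) / (2 / \<eta> * 2 ^ k)"
    proof (intro divide_left_mono)
      have "real k \<le> real (card T) / \<delta>" using False \<delta> by (simp add: field_simps)
      then have "(2::real) powr real k \<le> 2 powr (1 / \<delta> * real (card T))"
        by (intro powr_mono) auto
      then have "(2::real) ^ k \<le> (2 powr (1 / \<delta>)) ^ card T"
        by (simp only: powr_powr[symmetric]) (simp add: powr_realpow)
      moreover have "(2 / \<eta>) ^ 1 \<le> (2 / \<eta>) ^ card T"
        using \<eta> T(2) by (intro power_increasing) auto
      ultimately have "2 / \<eta> * 2 ^ k \<le> (2 / \<eta>) ^ card T * (2 powr (1 / \<delta>)) ^ card T"
        using \<eta> by (intro mult_mono) auto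
      also have "\<dots> = (2 * 2 powr (1 / \<delta>) / \<eta>) ^ card T"
        by (simp add: power_mult_distrib power_divide)
      also have "\<dots> \<le> B ^ card T" using B(2) \<eta> by (intro power_mono) auto
      finally show "2 / \<eta> * 2 ^ k \<le> B ^ card T" .
    qed (use B0 \<eta> in auto)
    also have "\<dots> = real (card H) * (0 + \<eta> / 2 / 2 ^ k)" using \<eta> by simp
    also have "\<dots> \<le> real (card H) *
        ((1 / 4 ^ D) ^ card T * x ^ ?c T * (4 ^ D / B) ^ Suc s + \<eta> / 2 / 2 ^ k)"
      using x B0 by (intro mult_left_mono add_right_mono) auto
    finally show ?thesis .
  qed
  have "(\<Sum>T | T \<subseteq> A \<and> s < card T. real (card {S'\<in>H. T \<subseteq> S'}) / (B * q) ^ card T) \<le>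
      (\<Sum>T | T \<subseteq> A \<and> s < card T.
        real (card H) * ((1 / 4 ^ D) ^ card T * x ^ ?c T * (4 ^ D / B) ^ Suc s + \<eta> / 2 / 2 ^ k))"
    by (intro sum_mono term_bound) auto
  also have "\<dots> \<le> (\<Sum>T\<in>Pow A.
        real (card H) * ((1 / 4 ^ D) ^ card T * x ^ ?c T * (4 ^ D / B) ^ Suc s + \<eta> / 2 / 2 ^ k))"
    using finA x B0 \<eta> by (intro sum_mono2) auto
  also have "\<dots> = real (card H) * ((\<Sum>T\<in>Pow A. (1 / 4 ^ D) ^ card T * x ^ ?c T) * (4 ^ D / B) ^ Suc s
      + \<eta> / 2 * (2 ^ card A / 2 ^ k))"
    using finA by (simp only: sum_distrib_left[symmetric] sum_distrib_right[symmetric] sum.distrib)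
      (simp add: card_Pow)
  \<comment> \<open>The component count with \<open>U = {}\<close> gives
    \<open>(1 + x) ^ card A \<le> exp (x * card A)\<close>, and the hypothesis on \<open>s\<close>
    makes this at most \<open>exp 1 ^ Suc s\<close>.\<close>
  also have "\<dots> \<le> real (card H) * (exp 1 ^ Suc s * (4 ^ D / B) ^ Suc s + \<eta> / 2 * 1)"
  proof (intro mult_left_mono add_mono mult_right_mono)
    have "(\<Sum>T\<in>Pow A. (1 / 4 ^ D) ^ card T * x ^ ?c T) \<le> (1 + x) ^ card A * 2 ^ card {e\<in>A. e \<inter> {} \<noteq> {}}"
      using finA degA x A(1) S(3) by (intro component_sum_bound) auto
    also have "\<dots> = (1 + x) ^ card A" by simp
    also have "\<dots> \<le> exp x ^ card A" using x by (intro power_mono) auto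
    also have "\<dots> = exp (x * real (card A))" by (simp add: exp_of_nat2_mult)
    also have "\<dots> \<le> exp (real (Suc s) * 1)" using A(2) by (simp add: x_def)
    also have "\<dots> = exp 1 ^ Suc s" by (rule exp_of_nat_mult)
    finally show "(\<Sum>T\<in>Pow A. (1 / 4 ^ D) ^ card T * x ^ ?c T) \<le> exp 1 ^ Suc s" .
    have "card A \<le> k" using A(1) S(2) finS card_mono by auto
    then show "(2::real) ^ card A / 2 ^ k \<le> 1" by (simp add: power_increasing)
  qed (use B0 \<eta> in auto)
  also have "\<dots> = real (card H) * ((exp 1 * 4 ^ D / B) ^ Suc s + \<eta> / 2)"
    by (simp add: power_mult_distrib power_divide)
  also have "\<dots> \<le> real (card H) * (\<eta> / 2 + \<eta> / 2)"
  proof (intro mult_left_mono add_right_mono)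
    have "(exp 1 * 4 ^ D / B) ^ Suc s \<le> (exp 1 * 4 ^ D / B) ^ 1"
      using order_trans[OF eB, of 1] \<eta> B0 by (intro power_decreasing) auto
    then show "(exp 1 * 4 ^ D / B) ^ Suc s \<le> \<eta> / 2"
      using eB by (simp only: power_one_right)
  qed auto
  finally show ?thesis by (simp add: mult.commute)
qed

section \<open>Copies in the random graph\<close>

lemma finite_complete_edges: "finite (complete_edges n)"
  by (rule finite_subset[of _ "Pow {1..n}"]) (auto simp: complete_edges_def)

lemma pmf_gnp:
  assumes p: "0 \<le> p" "p \<le> 1" and W: "W \<subseteq> complete_edges n"
  shows "pmf (gnp n p) W = subset_weight (complete_edges n) p W"
proof -
  let ?M = "complete_edges n" and ?P = "Pi_pmf (complete_edges n) False (\<lambda>_. bernoulli_pmf p)"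
  have "pmf (gnp n p) W = measure_pmf.prob ?P ((\<lambda>x. {e \<in> ?M. x e}) -` {W})"
    by (simp add: gnp_def pmf_map)
  \<comment> \<open>Functions that differ from the default \<open>False\<close> outside
    \<open>?M\<close> have mass 0, which leaves one function in the preimage.\<close>
  also have "\<dots> = measure_pmf.prob ?P {\<lambda>e. e \<in> W}"
  proof (rule measure_prob_cong_0)
    fix x assume x: "x \<in> (\<lambda>x. {e \<in> ?M. x e}) -` {W} - {\<lambda>e. e \<in> W}"
    then have "\<exists>e. x e \<noteq> (e \<in> W)" by auto
    then have "\<exists>e. e \<notin> ?M \<and> x e \<noteq> False" using x W by blast
    then show "pmf ?P x = 0" using finite_complete_edges by (intro pmf_Pi_outside) auto
  qed (use W in auto)
  also have "\<dots> = (\<Prod>e\<in>?M. if e \<in> W then p else 1 - p)"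
    using W finite_complete_edges p by (auto simp: measure_pmf_single pmf_Pi intro!: prod.cong)
  also have "\<dots> = subset_weight ?M p W"
    using W finite_complete_edges
    by (simp add: prod.If_cases subset_weight_def Int_absorb1 Diff_eq[symmetric])
  finally show ?thesis .
qed

lemma prob_gnp:
  assumes p: "0 \<le> p" "p \<le> 1"
  shows "measure_pmf.prob (gnp n p) U = subset_expectation (complete_edges n) p (\<lambda>W. of_bool (W \<in> U))"
proof -
  let ?M = "complete_edges n"
  have "measure_pmf.prob (gnp n p) U = measure_pmf.prob (gnp n p) (U \<inter> Pow ?M)"
  proof (rule measure_prob_cong_0)
    fix W assume "W \<in> U - U \<inter> Pow ?M"
    then have "W \<notin> set_pmf (gnp n p)" by (auto simp: gnp_def)
    then show "pmf (gnp n p) W = 0" by (simp add: set_pmf_iff)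
  qed auto
  also have "\<dots> = (\<Sum>W\<in>U \<inter> Pow ?M. pmf (gnp n p) W)"
    using finite_complete_edges by (intro measure_measure_pmf_finite) auto
  also have "\<dots> = (\<Sum>W\<in>U \<inter> Pow ?M. subset_weight ?M p W * of_bool (W \<in> U))"
    using p by (intro sum.cong) (auto simp: pmf_gnp)
  also have "\<dots> = subset_expectation ?M p (\<lambda>W. of_bool (W \<in> U))"
    unfolding subset_expectation_def using finite_complete_edges
    by (intro sum.mono_neutral_left) auto
  finally show ?thesis .
qed

lemma copies_properties:
  assumes F: "F \<subseteq> complete_edges n" and S: "S \<in> copies n F"
  shows "S \<subseteq> complete_edges n" "card S = card F" "vertex_degree S v \<le> max_degree F"
proof -
  obtain f where f: "inj_on f (\<Union>F)" "f ` \<Union>F \<subseteq> {1..n}" "S = (\<lambda>e. f ` e) ` F"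
    using S by (auto simp: copies_def)
  have finF: "finite F" using F finite_complete_edges finite_subset by auto
  have finV: "finite (\<Union>F)"
    by (rule finite_subset[of _ "{1..n}"]) (use F in \<open>auto simp: complete_edges_def\<close>)
  have inj: "inj_on ((`) f) F"
    by (rule inj_on_subset[OF inj_on_image_Pow[OF f(1)]]) auto
  show "card S = card F" using f(3) inj card_image by auto
  show "S \<subseteq> complete_edges n"
  proof
    fix e assume "e \<in> S"
    then obtain e' where e': "e' \<in> F" "e = f ` e'" using f(3) by auto
    have "inj_on f e'" using f(1) e'(1) by (auto intro: inj_on_subset)
    then have "card e = 2" using F e' by (auto simp: card_image complete_edges_def)
    then show "e \<in> complete_edges n" using e' f(2) by (auto simp: complete_edges_def)
  qed
  show "vertex_degree S v \<le> max_degree F"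
  proof (cases "v \<in> f ` \<Union>F")
    case True
    then obtain u where u: "u \<in> \<Union>F" "v = f u" by auto
    have "{e \<in> S. v \<in> e} \<subseteq> (`) f ` {e \<in> F. u \<in> e}"
      using u f by (auto simp: inj_on_def) blast
    then have "vertex_degree S v \<le> vertex_degree F u"
      unfolding vertex_degree_def using finF by (intro surj_card_le) auto
    also have "\<dots> \<le> max_degree F"
      unfolding max_degree_def using finV u by (intro Max_ge) auto
    finally show ?thesis .
  next
    case False
    then have "{e \<in> S. v \<in> e} = {}" using f(3) by auto
    then show ?thesis unfolding vertex_degree_def by (simp only: card.empty)
  qed
qed

section \<open>Choice of constants and conclusion\<close>

theorem theorem2p2:
  fixes d \<alpha> \<delta> \<epsilon> :: real
  assumes "d > 0" and "\<alpha> > 0" and "\<delta> > 0" and "\<epsilon> > 0" and "\<alpha> < 1" and "\<delta> < 1"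
  shows "\<exists>C\<^sub>0>0. \<forall>C\<ge>C\<^sub>0. \<forall>F :: nat \<Rightarrow> nat set set.
    (\<forall>n. F n \<subseteq> complete_edges n) \<longrightarrow>
    (\<lambda>n. real (card (F n))) \<in> \<omega>(\<lambda>_. 1) \<longrightarrow>
    (\<forall>n. \<forall>q :: real.
       real (max_degree (F n)) \<le> d \<longrightarrow>
       superspread (complete_edges n) (card (F n)) q \<alpha> \<delta> (copies n (F n)) \<longrightarrow>
       q \<ge> 4 * real (card (F n)) / (C * real n ^ 2) \<longrightarrow>
       (\<forall>p :: real. C * q \<le> p \<and> p \<le> 1 \<longrightarrow>
          measure_pmf.prob (gnp n p) {G. \<exists>A\<in>copies n (F n). A \<subseteq> G} \<ge> 1 - \<epsilon>))"
proof -
  define D where "D = nat \<lfloor>d\<rfloor>"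
  \<comment> \<open>Ensures \<open>\<alpha> * Suc j \<ge> 1\<close>, the condition for
    \<open>Suc j\<close> rounds to start from pieces of size \<open>k\<close>.\<close>
  define j where "j = nat \<lceil>1 / \<alpha>\<rceil>"
  \<comment> \<open>Chosen so that the failure bound \<open>Suc j * 2 ^ j * \<eta>\<close> of all
    rounds is at most \<epsilon>.\<close>
  define \<eta> where "\<eta> = min 1 \<epsilon> / (real (Suc j) * 2 ^ j)"
  define B\<^sub>0 where "B\<^sub>0 = max (2 * exp 1 * 4 ^ D / \<eta>) (2 * 2 powr (1 / \<delta>) / \<eta>)"
  have \<eta>: "0 < \<eta>" "real (Suc j) * 2 ^ j * \<eta> \<le> \<epsilon>"
    using \<open>\<epsilon> > 0\<close> by (auto simp: \<eta>_def field_simps simp del: of_nat_Suc)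
  have "1 * 1 \<le> real (Suc j) * 2 ^ j" by (intro mult_mono) auto
  then have \<eta>1: "\<eta> \<le> 1" unfolding \<eta>_def by (subst divide_le_eq_1_pos) auto
  have B0: "0 < B\<^sub>0" using \<eta>(1) by (auto simp: B\<^sub>0_def less_max_iff_disj)
  have goal: "1 - \<epsilon> \<le> measure_pmf.prob (gnp n p) {G. \<exists>A\<in>copies n F. A \<subseteq> G}"
    if C: "real (Suc j) * B\<^sub>0 \<le> C" and F: "F \<subseteq> complete_edges n" and deg: "real (max_degree F) \<le> d"
      and ss: "superspread (complete_edges n) (card F) q \<alpha> \<delta> (copies n F)"
      and p: "C * q \<le> p" "p \<le> 1" for C F n q p
  proof -
    let ?M = "complete_edges n" and ?H = "copies n F"
    define k where "k = card F"
    \<comment> \<open>Each round has rate \<open>B * q\<close>, so all rounds together use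
      \<open>C * q \<le> p\<close>.\<close>
    define B where "B = C / real (Suc j)"
    have B: "B\<^sub>0 \<le> B" using C by (simp add: B_def field_simps)
    have q: "0 < q" using ss by (simp add: superspread_def)
    have "0 < C" using C B0 by (smt (verit) mult_pos_pos of_nat_0_less_iff zero_less_Suc)
    then have p0: "0 \<le> p" using p(1) q by (smt (verit) mult_pos_pos)
    have "\<Union>F \<subseteq> {1..n}" using F by (auto simp: complete_edges_def)
    then have "F \<in> ?H"
      unfolding copies_def by (intro CollectI exI[of _ "\<lambda>v. v"]) auto
    note props = copies_properties[OF F]
    have maxD: "max_degree F \<le> D" using deg by (simp add: D_def le_nat_floor)
    have fail: "subset_expectation ?M p (\<lambda>W. of_bool (\<not> (\<exists>S\<in>?H. S \<subseteq> W))) \<le> \<epsilon>"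
    proof (cases "k = 0")
      \<comment> \<open>The empty copy lies in every \<open>W\<close>. This case is separate because
        \<open>0 powr (-\<alpha>) = 0\<close>, whereas the rounds require a positive factor
        \<open>x\<close>.\<close>
      case True
      have "finite F" using F finite_complete_edges finite_subset by auto
      then have "{} \<in> ?H" using True \<open>F \<in> ?H\<close> by (simp add: k_def)
      then have "(\<lambda>W. of_bool (\<not> (\<exists>S\<in>?H. S \<subseteq> W))) = (\<lambda>_. 0 :: real)" by (auto simp: fun_eq_iff)
      then show ?thesis
        using subset_expectation_const[OF finite_complete_edges] \<open>\<epsilon> > 0\<close> by auto
    next
      case False
      define x where "x = real k powr (-\<alpha>)"
      have "1 / \<alpha> \<le> real (Suc j)" unfolding j_def by linarith
      then have "1 \<le> \<alpha> * real (Suc j)" using \<open>\<alpha> > 0\<close> by (simp add: field_simps)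
      have x_pow: "real k * x ^ Suc j \<le> 1"
      proof -
        have "x ^ Suc j = real k powr (- (\<alpha> * real (Suc j)))"
          using False unfolding x_def by (subst powr_realpow[symmetric]) (auto simp: powr_powr)
        also have "\<dots> \<le> real k powr (-1)"
          using False \<open>1 \<le> \<alpha> * real (Suc j)\<close> by (intro powr_mono) auto
        also have "\<dots> = 1 / real k" using False by (simp add: powr_minus_divide)
        finally show ?thesis using False by (simp add: field_simps)
      qed
      \<comment> \<open>Initially all copies survive intact, hence \<open>i = 0\<close> and the
        identity for \<open>\<phi>\<close>.\<close>
      have "subset_expectation ?M p (\<lambda>W. of_bool (\<not> (\<exists>S\<in>?H. S \<subseteq> W))) \<le> real (Suc j) * 2 ^ (0 + j) * \<eta>"
      proof (rule iterated_fragments[where \<phi> = "\<lambda>S. S" and x = x and p\<^sub>0 = "B * q" and H = ?H])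
        show "finite ?M" by (rule finite_complete_edges)
        show "0 < B * q" using B B0 q by auto
        show "0 < x" using False by (simp add: x_def)
        show "(\<Sum>T | T \<subseteq> A \<and> s < card T. real (card {S'\<in>?H. T \<subseteq> S'}) / (B * q) ^ card T)
            \<le> \<eta> * real (card ?H)"
          if "S \<in> ?H" "A \<subseteq> S" "x * real (card A) \<le> real s + 1" for A S s
        proof (rule superspread_sum_bound[OF ss finite_complete_edges, where S = S and D = D])
          show "card e = 2" if "e \<in> S" for e
            using props(1)[OF \<open>S \<in> ?H\<close>] that by (auto simp: complete_edges_def)
          show "vertex_degree S v \<le> D" for v using props(3)[OF \<open>S \<in> ?H\<close>] maxD order_trans by blast
        qed (use that props \<eta> \<eta>1 B False in \<open>auto simp: B\<^sub>0_def k_def x_def\<close>)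
        show "real (card S) * x ^ Suc j \<le> 1" if "S \<in> ?H" for S
          using props(2)[OF that] x_pow by (simp add: k_def)
        show "real (Suc j) * (B * q) \<le> p" using p(1) by (simp add: B_def)
      qed (use props \<open>F \<in> ?H\<close> \<eta> p in auto)
      then show ?thesis using \<eta>(2) by simp
    qed
    have "(\<lambda>W. of_bool (\<not> (\<exists>S\<in>?H. S \<subseteq> W))) =
        (\<lambda>W. 1 * 1 + (-1) * of_bool (W \<in> {G. \<exists>A\<in>?H. A \<subseteq> G}) :: real)"
      by auto
    then have "subset_expectation ?M p (\<lambda>W. of_bool (\<not> (\<exists>S\<in>?H. S \<subseteq> W))) =
        1 - measure_pmf.prob (gnp n p) {G. \<exists>A\<in>?H. A \<subseteq> G}"
      unfolding prob_gnp[OF p0 p(2)]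
      by (simp only: subset_expectation_linear subset_expectation_const[OF finite_complete_edges])
    then show ?thesis using fail by linarith
  qed
  show ?thesis
    by (rule exI[of _ "real (Suc j) * B\<^sub>0"]) (use goal B0 in auto)
qed

end
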